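(* Let $\|\cdot\|$ be a smooth and strictly convex norm on $\mathbb{R}^n$ and let $f:\mathbb{R}^n\to\mathbb{R}$ be a convex function. Let $x\in\mathbb{R}^n$, assume that $f(x)=c$ is not a global minimum of $f$, and that the hyperplane $\mathbf{h}$ supports $\{f\le c\}$ at $x$. If $v\in\mathbb{R}^n$ is a vector such that (i) $v\dashv_B\mathbf{h}$, and (ii) $\sup\{f'_-(x,v+z):z\in\mathbf{h}\}\le\|v\|^2\le\inf\{f'_+(x,v+z):z\in\mathbf{h}\}$, then $v$ is a norm sub-gradient of $f$ at $x$.
   Context: A norm is smooth if its unit ball $B=\{x:\|x\|\le 1\}$ has a unique supporting hyperplane at each boundary point, and strictly convex if $\partial B$ contains no (non-degenerate) line segment. A hyperplane $\mathbf{h}$ (regarded as a linear hyperplane through the origin) supports a closed convex set $C$ at $x\in\partial C$ if $C$ is contained in one of the closed half-spaces determined by the translate $x+\mathbf{h}$. The sub-level set is $\{f\le c\}=\{z\in\mathbb{R}^n:f(z)\le c\}$. Birkhoff orthogonality: $x\dashv_B y$ means $\|x+ty\|\ge\|x\|$ for all $t\in\mathbb{R}$; $x\dashv_B\mathbf{h}$ means $x\dashv_B z$ for all $z\in\mathbf{h}$, and then $\mathbf{h}$ is called Birkhoff right-orthogonal to $x$. Each non-zero vector has a unique Birkhoff right-orthogonal hyperplane because the norm is smooth. Legendre transform: $\mathcal{L}:\mathbb{R}^n\to(\mathbb{R}^n)^*$ sends $x\ne 0$ to the unique linear functional $\mathcal{L}(x)$ whose kernel is the hyperplane Birkhoff right-orthogonal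 to $x$ and with $\mathcal{L}(x)\cdot x=\|x\|^2$; $\mathcal{L}(0)=0$. A vector $v$ is a norm sub-gradient of $f$ at $x$ if $f(y)-f(x)\ge\mathcal{L}(v)\cdot(y-x)$ for all $y\in\mathbb{R}^n$. One-sided derivatives: $f'_+(x,u)=\lim_{t\to0^+}\frac{f(x+tu)-f(x)}{t}$ and $f'_-(x,u)=\lim_{t\to0^-}\frac{f(x+tu)-f(x)}{t}=-f'_+(x,-u)$.
   Formalization: The vector v is assumed to be non-zero; for v = 0 the claim fails (n = 1, f(t) = t, x = 0, h = {0}: (i) and (ii) hold, but 0 is a norm sub-gradient only at a global minimum). *)

theory Defs
  imports "HOL-Analysis.Analysis"
begin

(* The norm is an arbitrary function N, unrelated to the Euclidean norm carried by the
   type real ^ 'n.  The topology of the type (used by frontier) is the one induced by any such N,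
   since all norms on a finite-dimensional space are equivalent. *)

definition is_norm :: "(real ^ 'n \<Rightarrow> real) \<Rightarrow> bool" where
  "is_norm N \<longleftrightarrow>
     (\<forall>x. N x = 0 \<longleftrightarrow> x = 0) \<and>
     (\<forall>a x. N (a *\<^sub>R x) = \<bar>a\<bar> * N x) \<and>
     (\<forall>x y. N (x + y) \<le> N x + N y)"

definition unit_ball :: "(real ^ 'n \<Rightarrow> real) \<Rightarrow> (real ^ 'n) set" where
  "unit_ball N = {x. N x \<le> 1}"

definition linear_hyperplane :: "(real ^ 'n) set \<Rightarrow> bool" where
  "linear_hyperplane h \<longleftrightarrow> subspace h \<and> dim h + 1 = CARD('n)"

(* Both closed half-spaces bounded by x + h are covered: phi may be replaced by - phi. *)
definition supports_at :: "(real ^ 'n) set \<Rightarrow> (real ^ 'n) set \<Rightarrow> real ^ 'n \<Rightarrow> bool" where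
  "supports_at h C x \<longleftrightarrow>
     linear_hyperplane h \<and> x \<in> frontier C \<and>
     (\<exists>\<phi> :: real ^ 'n \<Rightarrow> real. linear \<phi> \<and> {z. \<phi> z = 0} = h \<and> C \<subseteq> {y. \<phi> y \<le> \<phi> x})"

definition smooth_norm :: "(real ^ 'n \<Rightarrow> real) \<Rightarrow> bool" where
  "smooth_norm N \<longleftrightarrow> (\<forall>x \<in> frontier (unit_ball N). \<exists>!h. supports_at h (unit_ball N) x)"

definition strictly_convex_norm :: "(real ^ 'n \<Rightarrow> real) \<Rightarrow> bool" where
  "strictly_convex_norm N \<longleftrightarrow>
     \<not> (\<exists>a b. a \<noteq> b \<and> closed_segment a b \<subseteq> frontier (unit_ball N))"

definition birkhoff_orth :: "(real ^ 'n \<Rightarrow> real) \<Rightarrow> real ^ 'n \<Rightarrow> real ^ 'n \<Rightarrow> bool" where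
  "birkhoff_orth N x y \<longleftrightarrow> (\<forall>t::real. N (x + t *\<^sub>R y) \<ge> N x)"

definition birkhoff_orth_set :: "(real ^ 'n \<Rightarrow> real) \<Rightarrow> real ^ 'n \<Rightarrow> (real ^ 'n) set \<Rightarrow> bool" where
  "birkhoff_orth_set N x h \<longleftrightarrow> (\<forall>z \<in> h. birkhoff_orth N x z)"

(* For a smooth norm the functional exists and is unique; otherwise the value at x need not be
   determined. *)
definition legendre :: "(real ^ 'n \<Rightarrow> real) \<Rightarrow> real ^ 'n \<Rightarrow> (real ^ 'n \<Rightarrow> real)" where
  "legendre N x =
     (if x = 0 then (\<lambda>_. 0)
      else (THE \<phi>. linear \<phi> \<and> linear_hyperplane {z. \<phi> z = 0} \<and>
                   birkhoff_orth_set N x {z. \<phi> z = 0} \<and> \<phi> x = (N x)\<^sup>2))"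

definition norm_subgradient ::
  "(real ^ 'n \<Rightarrow> real) \<Rightarrow> (real ^ 'n \<Rightarrow> real) \<Rightarrow> real ^ 'n \<Rightarrow> real ^ 'n \<Rightarrow> bool" where
  "norm_subgradient N f x v \<longleftrightarrow> (\<forall>y. f y - f x \<ge> legendre N v (y - x))"

(* For convex f : R^n -> R both limits exist and are finite. *)
definition right_deriv :: "(real ^ 'n \<Rightarrow> real) \<Rightarrow> real ^ 'n \<Rightarrow> real ^ 'n \<Rightarrow> real" where
  "right_deriv f x u = Lim (at_right 0) (\<lambda>t::real. (f (x + t *\<^sub>R u) - f x) / t)"

definition left_deriv :: "(real ^ 'n \<Rightarrow> real) \<Rightarrow> real ^ 'n \<Rightarrow> real ^ 'n \<Rightarrow> real" where
  "left_deriv f x u = Lim (at_left 0) (\<lambda>t::real. (f (x + t *\<^sub>R u) - f x) / t)"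

end

theory Submission
  imports Defs
begin

text \<open>Write \<open>y - x = a v + z\<close> with \<open>z \<in> h\<close>, so that \<open>\<L>(v) \<cdot> (y - x) = a \<parallel>v\<parallel>\<^sup>2\<close>. For \<open>a \<noteq> 0\<close> put
  \<open>u = v + z / a\<close>: a convex function lies above its one-sided tangents, so \<open>f y - f x\<close> is at
  least \<open>a f'\<^sub>+(x,u)\<close> or \<open>a f'\<^sub>-(x,u)\<close> according to the sign of \<open>a\<close>, and (ii) applies. For
  \<open>a = 0\<close> let \<open>a\<close> decrease to \<open>0\<close> along \<open>x + z + a v\<close>.\<close>

section \<open>One-sided derivatives of convex functions\<close>

lemma convex_slope_mono:
  fixes f :: "'a::real_vector \<Rightarrow> real"
  assumes "convex_on UNIV f" and "0 < s" and "s \<le> t"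
  shows "(f (x + s *\<^sub>R u) - f x) / s \<le> (f (x + t *\<^sub>R u) - f x) / t"
proof -
  have "f ((1 - s/t) *\<^sub>R x + (s/t) *\<^sub>R (x + t *\<^sub>R u)) \<le> (1 - s/t) * f x + (s/t) * f (x + t *\<^sub>R u)"
    using assms by (intro convex_onD[of UNIV]) auto
  moreover have "(1 - s/t) *\<^sub>R x + (s/t) *\<^sub>R (x + t *\<^sub>R u) = x + s *\<^sub>R u"
    using assms by (simp add: algebra_simps)
  ultimately have "f (x + s *\<^sub>R u) \<le> (1 - s/t) * f x + (s/t) * f (x + t *\<^sub>R u)"
    by simp
  then have "f (x + s *\<^sub>R u) - f x \<le> s * ((f (x + t *\<^sub>R u) - f x) / t)"
    by (simp add: algebra_simps diff_divide_distrib)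
  then show ?thesis
    using assms by (simp add: pos_divide_le_eq mult.commute)
qed

text \<open>The point \<open>x\<close> lies between \<open>x - u\<close> and \<open>x + t u\<close>.
  Since the bound does not depend on \<open>t\<close>, the infimum of the forward slopes is
  finite.\<close>

lemma convex_slope_ge:
  fixes f :: "'a::real_vector \<Rightarrow> real"
  assumes "convex_on UNIV f" and "0 < t"
  shows "f x - f (x - u) \<le> (f (x + t *\<^sub>R u) - f x) / t"
proof -
  \<comment> \<open>The weight is determined by \<open>(1 - w) * (-1) + w * t = 0\<close>, which
    makes the combination of \<open>x - u\<close> and \<open>x + t u\<close> equal to
    \<open>x\<close>.\<close>
  define w where "w = 1 / (1 + t)"
  have w: "0 \<le> w" "w \<le> 1" "w * (1 + t) = 1"
    using assms by (auto simp: w_def)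
  have "f ((1 - w) *\<^sub>R (x - u) + w *\<^sub>R (x + t *\<^sub>R u)) \<le> (1 - w) * f (x - u) + w * f (x + t *\<^sub>R u)"
    using assms w by (intro convex_onD[of UNIV]) auto
  moreover have "(1 - w) *\<^sub>R (x - u) + w *\<^sub>R (x + t *\<^sub>R u) = x + (w * (1 + t) - 1) *\<^sub>R u"
    by (simp add: algebra_simps)
  ultimately have "f x \<le> (1 - w) * f (x - u) + w * f (x + t *\<^sub>R u)"
    using w by simp
  moreover have "1 - w = t * w"
    using w by (simp add: algebra_simps)
  ultimately have "(1 + t) * f x \<le> (1 + t) * (t * w * f (x - u) + w * f (x + t *\<^sub>R u))"
    using assms by (intro mult_left_mono) auto
  also have "\<dots> = (w * (1 + t)) * (t * f (x - u) + f (x + t *\<^sub>R u))"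
    by (simp add: algebra_simps)
  finally show ?thesis
    using assms w by (simp add: field_simps)
qed

text \<open>As \<open>t\<close> decreases to 0 the slopes decrease and stay bounded below, so they
  converge to their infimum \<open>L\<close>. The tangent inequality then only says that the slope
  at \<open>a\<close> is at least \<open>L\<close>.\<close>

lemma convex_right_deriv:
  assumes "convex_on UNIV f"
  shows convex_right_deriv_tendsto:
      "((\<lambda>t. (f (x + t *\<^sub>R u) - f x) / t) \<longlongrightarrow> right_deriv f x u) (at_right 0)"
    and convex_ge_right_deriv: "0 < a \<Longrightarrow> f x + a * right_deriv f x u \<le> f (x + a *\<^sub>R u)"
proof -
  define q where "q t = (f (x + t *\<^sub>R u) - f x) / t" for t
  define L where "L = Inf (q ` {0<..})"
  have bdd: "bdd_below (q ` {0<..})"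
    using convex_slope_ge[OF assms] by (auto simp: q_def bdd_below_def)
  have L_le: "L \<le> q t" if "0 < t" for t
    unfolding L_def using bdd that by (intro cInf_lower) auto
  have lim: "(q \<longlongrightarrow> L) (at_right 0)"
  proof (rule order_tendstoI)
    fix b assume "b < L"
    then show "\<forall>\<^sub>F t in at_right 0. b < q t"
      unfolding eventually_at_right_field using L_le by (intro exI[of _ 1]) force
  next
    fix b assume "L < b"
    then obtain t where "0 < t" "q t < b"
      using cInf_lessD[of "q ` {0<..}" b] by (auto simp: L_def)
    moreover have "q s \<le> q t" if "0 < s" "s < t" for s
      using convex_slope_mono[OF assms] that by (simp add: q_def)
    ultimately show "\<forall>\<^sub>F t in at_right 0. q t < b"
      unfolding eventually_at_right_field by (intro exI[of _ t]) force
  qed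
  have eq: "right_deriv f x u = L"
    using lim unfolding right_deriv_def q_def by (intro tendsto_Lim) auto
  show "((\<lambda>t. (f (x + t *\<^sub>R u) - f x) / t) \<longlongrightarrow> right_deriv f x u) (at_right 0)"
    using lim by (simp add: eq q_def[abs_def])
  show "f x + a * right_deriv f x u \<le> f (x + a *\<^sub>R u)" if "0 < a"
    using L_le[OF that] that by (simp add: eq q_def pos_le_divide_eq mult.commute)
qed

text \<open>Reflecting \<open>t\<close> to \<open>- t\<close> turns the left derivative along
  \<open>u\<close> into minus the right derivative along \<open>- u\<close>, and the step
  \<open>a < 0\<close> into the positive step \<open>- a\<close>.\<close>

lemma convex_ge_left_deriv:
  assumes "convex_on UNIV f" and "a < 0"
  shows "f x + a * left_deriv f x u \<le> f (x + a *\<^sub>R u)"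
proof -
  have "((\<lambda>t. - ((f (x + t *\<^sub>R (- u)) - f x) / t)) \<longlongrightarrow> - right_deriv f x (- u)) (at_right 0)"
    by (intro tendsto_minus convex_right_deriv_tendsto assms(1))
  then have "((\<lambda>t. (f (x + t *\<^sub>R u) - f x) / t) \<longlongrightarrow> - right_deriv f x (- u)) (at_left 0)"
    by (simp add: filterlim_at_left_to_right)
  then have "left_deriv f x u = - right_deriv f x (- u)"
    unfolding left_deriv_def by (intro tendsto_Lim) auto
  then show ?thesis
    using convex_ge_right_deriv[OF assms(1), of "- a" x "- u"] assms(2) by simp
qed

section \<open>Norms, Birkhoff orthogonality and the Legendre transform\<close>

text \<open>Nonnegativity is not among the axioms in \<open>is_norm\<close>; it comes from
  \<open>0 = N (x - x) \<le> 2 * N x\<close>.\<close>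

lemma is_norm_nonneg: "is_norm N \<Longrightarrow> 0 \<le> N x"
proof -
  assume N: "is_norm N"
  have "N (x + (-1) *\<^sub>R x) \<le> N x + N ((-1) *\<^sub>R x)" "N ((-1) *\<^sub>R x) = \<bar>-1\<bar> * N x" "N 0 = 0"
    using N unfolding is_norm_def by blast+
  then show ?thesis by simp
qed

lemma is_norm_pos: "is_norm N \<Longrightarrow> x \<noteq> 0 \<Longrightarrow> 0 < N x"
  using is_norm_nonneg[of N x] unfolding is_norm_def less_le by metis

text \<open>The frontier is Euclidean while the ball belongs to \<open>N\<close>. Stretching the
  normalized vector along its own ray moves it arbitrarily little in the Euclidean sense, yet pushes
  \<open>N\<close> above 1.\<close>

lemma normalized_in_frontier_unit_ball:
  assumes N: "is_norm N" and v: "v \<noteq> 0"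
  shows "(1 / N v) *\<^sub>R v \<in> frontier (unit_ball N)"
proof -
  define w where "w = (1 / N v) *\<^sub>R v"
  have Nw: "N (a *\<^sub>R w) = \<bar>a\<bar>" for a
    using N v is_norm_pos[OF N v] by (simp add: is_norm_def w_def)
  have "w \<in> unit_ball N"
    using Nw[of 1] by (simp add: unit_ball_def)
  moreover have "w \<notin> interior (unit_ball N)"
  proof
    assume "w \<in> interior (unit_ball N)"
    then obtain e where e: "0 < e" "ball w e \<subseteq> unit_ball N"
      by (auto simp: mem_interior)
    have nw: "0 < norm w"
      using is_norm_pos[OF N v] v by (simp add: w_def)
    \<comment> \<open>This puts \<open>(1 + d) w\<close> at Euclidean distance \<open>e / 2\<close>
      from \<open>w\<close>.\<close>
    define d where "d = e / 2 / norm w"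
    have "dist w ((1 + d) *\<^sub>R w) = \<bar>d\<bar> * norm w"
      by (simp add: dist_norm scaleR_left_distrib)
    also have "\<dots> < e"
      using nw e by (simp add: d_def)
    finally have "N ((1 + d) *\<^sub>R w) \<le> 1"
      using e by (auto simp: unit_ball_def)
    moreover have "0 < d"
      using nw e unfolding d_def by simp
    ultimately show False
      unfolding Nw by simp
  qed
  ultimately show ?thesis
    using closure_subset[of "unit_ball N"] by (auto simp: frontier_def w_def)
qed

text \<open>Write \<open>y = a v + k\<close> with \<open>k\<close> in the kernel. For
  \<open>a \<noteq> 0\<close>, orthogonality gives \<open>N y = \<bar>a\<bar> * N (v + k / a) \<ge>
  \<bar>a\<bar> * N v\<close>, while \<open>\<phi> y\<close> is \<open>a\<close> times the square of
  \<open>N v\<close>.\<close>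

lemma birkhoff_orth_kernel_bound:
  assumes N: "is_norm N" and lin: "linear \<phi>" and v: "v \<noteq> 0"
    and orth: "birkhoff_orth_set N v {z. \<phi> z = 0}" and val: "\<phi> v = (N v)\<^sup>2"
  shows "\<phi> y \<le> N v * N y"
proof (cases "\<phi> y = 0")
  case True
  then show ?thesis using is_norm_nonneg[OF N] by simp
next
  case False
  define a where "a = \<phi> y / \<phi> v"
  have pos: "0 < N v" using is_norm_pos[OF N v] .
  have a: "a \<noteq> 0" "\<phi> y = a * (N v)\<^sup>2"
    using False pos val by (auto simp: a_def)
  have "\<phi> (y - a *\<^sub>R v) = 0"
    using a val by (simp add: linear_diff[OF lin] linear_scale[OF lin])
  then have "N v \<le> N (v + (1 / a) *\<^sub>R (y - a *\<^sub>R v))"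
    using orth unfolding birkhoff_orth_set_def birkhoff_orth_def by blast
  also have "v + (1 / a) *\<^sub>R (y - a *\<^sub>R v) = (1 / a) *\<^sub>R y"
    using a by (simp add: algebra_simps)
  also have "N \<dots> = N y / \<bar>a\<bar>"
    using N by (simp add: is_norm_def)
  finally have "\<bar>a\<bar> * N v \<le> N y"
    using a by (simp add: field_simps)
  then have "N v * (\<bar>a\<bar> * N v) \<le> N v * N y"
    using pos by simp
  moreover have "a * (N v)\<^sup>2 \<le> \<bar>a\<bar> * (N v)\<^sup>2"
    by (intro mult_right_mono) auto
  ultimately show ?thesis
    using a by (simp add: power2_eq_square mult.commute mult.left_commute)
qed

text \<open>On the unit ball \<phi> is at most \<open>N v\<close>, and it attains this value at the
  normalized \<open>v\<close>. This lets smoothness, a statement about supporting hyperplanes, speak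
  about Birkhoff orthogonality.\<close>

lemma birkhoff_orth_supports_unit_ball:
  assumes "is_norm N" and "linear \<phi>" and "v \<noteq> 0" and "linear_hyperplane {z. \<phi> z = 0}"
    and "birkhoff_orth_set N v {z. \<phi> z = 0}" and "\<phi> v = (N v)\<^sup>2"
  shows "supports_at {z. \<phi> z = 0} (unit_ball N) ((1 / N v) *\<^sub>R v)"
proof -
  have pos: "0 < N v" using is_norm_pos assms(1,3) .
  have "\<phi> ((1 / N v) *\<^sub>R v) = N v"
    using pos assms(6) by (simp add: linear_scale[OF assms(2)] power2_eq_square)
  moreover have "\<phi> y \<le> N v" if "N y \<le> 1" for y
  proof -
    have "\<phi> y \<le> N v * N y"
      using birkhoff_orth_kernel_bound assms by blast
    also have "\<dots> \<le> N v" using pos that by (simp add: mult_left_le)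
    finally show ?thesis .
  qed
  ultimately show ?thesis
    using assms normalized_in_frontier_unit_ball
    unfolding supports_at_def by (auto simp: unit_ball_def)
qed

text \<open>Subtracting the right multiple of \<open>v\<close> moves any \<open>y\<close> into the
  common kernel, so the values at \<open>v\<close> determine both functionals.\<close>

lemma linear_eq_if_same_kernel:
  fixes \<phi> \<psi> :: "'a::real_vector \<Rightarrow> real"
  assumes "linear \<phi>" and "linear \<psi>" and ker: "{z. \<phi> z = 0} = {z. \<psi> z = 0}"
    and "\<phi> v = \<psi> v" and "\<phi> v \<noteq> 0"
  shows "\<phi> = \<psi>"
proof
  fix y
  have "\<phi> (y - (\<phi> y / \<phi> v) *\<^sub>R v) = 0"
    using assms by (simp add: linear_diff linear_scale)
  then have "\<psi> (y - (\<phi> y / \<phi> v) *\<^sub>R v) = 0"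
    using ker by blast
  then show "\<phi> y = \<psi> y"
    using assms by (simp add: linear_diff linear_scale)
qed

text \<open>Evaluates the definite description: the kernels of two candidates support the ball at
  the same point, so smoothness identifies them, and the prescribed value at \<open>v\<close> fixes
  the scale.\<close>

lemma legendre_eqI:
  assumes "is_norm N" and "smooth_norm N" and "v \<noteq> 0"
    and "linear \<phi>" and "linear_hyperplane {z. \<phi> z = 0}"
    and "birkhoff_orth_set N v {z. \<phi> z = 0}" and "\<phi> v = (N v)\<^sup>2"
  shows "legendre N v = \<phi>"
proof -
  have "\<psi> = \<phi>"
    if \<psi>: "linear \<psi>" "linear_hyperplane {z. \<psi> z = 0}"
      "birkhoff_orth_set N v {z. \<psi> z = 0}" "\<psi> v = (N v)\<^sup>2" for \<psi>
  proof -
    have "supports_at {z. \<psi> z = 0} (unit_ball N) ((1 / N v) *\<^sub>R v)"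
      by (intro birkhoff_orth_supports_unit_ball assms(1,3) \<psi>)
    moreover have "supports_at {z. \<phi> z = 0} (unit_ball N) ((1 / N v) *\<^sub>R v)"
      by (intro birkhoff_orth_supports_unit_ball assms)
    moreover have "\<exists>!k. supports_at k (unit_ball N) ((1 / N v) *\<^sub>R v)"
      using assms(2) normalized_in_frontier_unit_ball[OF assms(1,3)] unfolding smooth_norm_def
      by (rule bspec)
    ultimately have ker: "{z. \<psi> z = 0} = {z. \<phi> z = 0}"
      by auto
    have "\<psi> v = \<phi> v" "\<psi> v \<noteq> 0"
      using \<psi>(4) assms(7) is_norm_pos[OF assms(1,3)] by simp_all
    then show ?thesis
      by (rule linear_eq_if_same_kernel[OF \<psi>(1) assms(4) ker])
  qed
  then have "(THE \<psi>. linear \<psi> \<and> linear_hyperplane {z. \<psi> z = 0} \<and>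
      birkhoff_orth_set N v {z. \<psi> z = 0} \<and> \<psi> v = (N v)\<^sup>2) = \<phi>"
    using assms(4-7) by (intro the_equality) blast+
  then show ?thesis
    using assms(3) by (simp add: legendre_def)
qed

theorem theorem4p5:
  fixes N f :: "real ^ 'n \<Rightarrow> real" and x v :: "real ^ 'n" and c :: real
    and h :: "(real ^ 'n) set"
  assumes "is_norm N" and "smooth_norm N" and "strictly_convex_norm N"
    and "convex_on UNIV f"
    and "f x = c" and "\<not> (\<forall>y. c \<le> f y)"
    and "supports_at h {z. f z \<le> c} x"
    and "v \<noteq> 0"
    and "birkhoff_orth_set N v h"
    and "(SUP z\<in>h. ereal (left_deriv f x (v + z))) \<le> ereal ((N v)\<^sup>2)"
    and "ereal ((N v)\<^sup>2) \<le> (INF z\<in>h. ereal (right_deriv f x (v + z)))"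
  shows "norm_subgradient N f x v"
proof -
  obtain \<phi>0 :: "real ^ 'n \<Rightarrow> real" where \<phi>0: "linear \<phi>0" "{z. \<phi>0 z = 0} = h"
    and hyp: "linear_hyperplane h"
    using assms(7) by (auto simp: supports_at_def)
  have h: "subspace h"
    using hyp by (simp add: linear_hyperplane_def)
  have pos: "0 < N v" using is_norm_pos assms(1,8) .
  \<comment> \<open>Otherwise \<open>v\<close> would be Birkhoff orthogonal to itself, and
    \<open>t = -1\<close> would give \<open>N v \<le> N 0 = 0\<close>.\<close>
  have "v \<notin> h"
  proof
    assume "v \<in> h"
    then have "N v \<le> N (v + (-1) *\<^sub>R v)"
      using assms(9) unfolding birkhoff_orth_set_def birkhoff_orth_def by blast
    moreover have "N 0 = 0" using assms(1) by (simp add: is_norm_def)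
    ultimately show False using pos by simp
  qed
  then have \<phi>0v: "\<phi>0 v \<noteq> 0" using \<phi>0 by auto
  \<comment> \<open>Rescaling, possibly by a negative factor, keeps the kernel \<open>h\<close> and
    gives the value at \<open>v\<close> required of the Legendre functional.\<close>
  define \<phi> where "\<phi> z = ((N v)\<^sup>2 / \<phi>0 v) * \<phi>0 z" for z
  have lin: "linear \<phi>"
    using linear_compose_scale_right[OF \<phi>0(1), of "(N v)\<^sup>2 / \<phi>0 v"] by (simp add: \<phi>_def[abs_def])
  have ker: "{z. \<phi> z = 0} = h"
    using pos \<phi>0v \<phi>0(2) by (auto simp: \<phi>_def)
  have \<phi>v: "\<phi> v = (N v)\<^sup>2"
    using \<phi>0v by (simp add: \<phi>_def)
  have leg: "legendre N v = \<phi>"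
    using assms lin ker \<phi>v hyp by (intro legendre_eqI) auto
  \<comment> \<open>The supremum lives in \<open>ereal\<close>, where it bounds every member even of
    an unbounded family; likewise the infimum below.\<close>
  have left: "left_deriv f x (v + z) \<le> (N v)\<^sup>2" if "z \<in> h" for z
    using assms(10) that by (simp add: SUP_le_iff)
  have right: "(N v)\<^sup>2 \<le> right_deriv f x (v + z)" if "z \<in> h" for z
    using assms(11) that by (simp add: le_INF_iff)
  have off: "f x + a * (N v)\<^sup>2 \<le> f (x + (z + a *\<^sub>R v))" if "z \<in> h" "a \<noteq> 0" for z a
  proof -
    let ?u = "v + (1 / a) *\<^sub>R z"
    have z: "(1 / a) *\<^sub>R z \<in> h"
      using h that by (simp add: subspace_scale)
    have u: "a *\<^sub>R ?u = z + a *\<^sub>R v"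
      using that by (simp add: algebra_simps)
    show ?thesis
    proof (cases "0 < a")
      case True
      have "a * (N v)\<^sup>2 \<le> a * right_deriv f x ?u"
        using True right[OF z] by simp
      with convex_ge_right_deriv[OF assms(4) True, of x ?u] show ?thesis
        by (simp add: u)
    next
      case False
      with that have a: "a < 0" by simp
      \<comment> \<open>Multiplying by \<open>a < 0\<close> reverses the inequality, so an upper
        bound on the left derivative is what serves here.\<close>
      have "a * (N v)\<^sup>2 \<le> a * left_deriv f x ?u"
        using a left[OF z] by simp
      with convex_ge_left_deriv[OF assms(4) a, of x ?u] show ?thesis
        by (simp add: u)
    qed
  qed
  have on: "f x \<le> f (x + z)" if "z \<in> h" for z
  proof -
    have "((\<lambda>a. f x + a * (N v)\<^sup>2) \<longlongrightarrow> f x + 0 * (N v)\<^sup>2) (at_right 0)"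
      by (intro tendsto_intros)
    \<comment> \<open>The chord from \<open>x + z\<close> to \<open>x + z + v\<close> dominates
      \<open>f\<close> and is affine in \<open>a\<close>, so its limit is evident; it stands in for
      continuity of \<open>f\<close> at \<open>x + z\<close>.\<close>
    moreover have "((\<lambda>a. (1 - a) * f (x + z) + a * f (x + z + v))
        \<longlongrightarrow> (1 - 0) * f (x + z) + 0 * f (x + z + v)) (at_right 0)"
      by (intro tendsto_intros)
    moreover have "\<forall>\<^sub>F a in at_right 0. f x + a * (N v)\<^sup>2 \<le> (1 - a) * f (x + z) + a * f (x + z + v)"
      unfolding eventually_at_right_field
    proof (intro exI[of _ 1] conjI allI impI)
      fix a :: real assume a: "0 < a" "a < 1"
      have "f x + a * (N v)\<^sup>2 \<le> f (x + (z + a *\<^sub>R v))"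
        using off that a by simp
      also have "x + (z + a *\<^sub>R v) = (1 - a) *\<^sub>R (x + z) + a *\<^sub>R (x + z + v)"
        by (simp add: algebra_simps)
      also have "f \<dots> \<le> (1 - a) * f (x + z) + a * f (x + z + v)"
        using assms(4) a by (intro convex_onD[of UNIV]) auto
      finally show "f x + a * (N v)\<^sup>2 \<le> (1 - a) * f (x + z) + a * f (x + z + v)" .
    qed simp
    ultimately have "f x + 0 * (N v)\<^sup>2 \<le> (1 - 0) * f (x + z) + 0 * f (x + z + v)"
      by (intro tendsto_le[of "at_right 0"]) auto
    then show ?thesis by simp
  qed
  have "\<phi> (y - x) \<le> f y - f x" for y
  proof -
    \<comment> \<open>\<open>a v\<close> is the projection of \<open>y - x\<close> onto the line of
      \<open>v\<close> along \<open>h\<close>, because \<open>\<phi> v\<close> is the square of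
      \<open>N v\<close>.\<close>
    define a where "a = \<phi> (y - x) / (N v)\<^sup>2"
    define z where "z = y - x - a *\<^sub>R v"
    have a: "\<phi> (y - x) = a * (N v)\<^sup>2"
      using pos by (simp add: a_def)
    have "\<phi> z = \<phi> (y - x) - a * \<phi> v"
      by (simp add: z_def linear_diff[OF lin] linear_scale[OF lin])
    then have z: "z \<in> h"
      using a \<phi>v ker by auto
    have "y = x + (z + a *\<^sub>R v)"
      by (simp add: z_def)
    then show ?thesis
      using a off[OF z, of a] on[OF z] by (cases "a = 0") auto
  qed
  then show ?thesis
    by (simp add: norm_subgradient_def leg)
qed

end
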